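(* For every $h\in[H]$, every $s\in\mathcal S$ and every $b\in\mathcal B$, $$\bar V^*_h(s,b)=\max_{a\in\mathcal A_h(s)}\big[r_h(s,a)+\bar V^{s,a}_{h,b}(1,0)\big].$$
   Context: Cost-accumulating MDP. Fix $H,m\in\mathbb N$. A finite-horizon tabular cost-accumulating MDP consists of: - states $\mathcal S=\{1,\dots,S\}$; - finite action sets $\mathcal A_h(s)$; - transitions $P_h(\cdot\mid s,a)$; - expected rewards $r_h(s,a)$; - deterministic costs $c_h(s,a)\in\mathbb R^m$; - an initial state $s_0$. Vector inequalities are componentwise. SR functions. Let $f:\mathbb R^m\times\mathbb R^m\to\mathbb R^m$ satisfy: - $f$ is associative; - $f$ is componentwise non-decreasing in each argument; - $f$ is $1$-Lipschitz in each argument for $\|\cdot\|_\infty$; - $f(0,x)=f(x,0)=x$. Let $g:[0,1]\to[0,1]$ satisfy $g(0)=0$. Write $f_{s'}y_{s'}=f(y_1,f(y_2,\dots,y_S))$. Assume $x\mapsto f_{s'}g(p_{s'})x_{s'}$ is $1$-Lipschitz for $\|\cdot\|_\infty$ for every probability vector $p$. SR cost. For deterministic history-dependent policies $\pi$ and histories $\tau_h$, $C^\pi_{H+1}\equiv0$ and $C^\pi_h(\tau_h)=c_h(s,a)+f_{s'}g(P_h(s'\mid s,a))C^\pi_{h+1}(\tau_h,a,s')$. $\mathcal B$ is the finite set of all values $C^\pi_h(\tau_h)$. Reduced optimal values. $\bar V^*_{H+1}(s,b)=0$ if $b\ge0$ and $-\infty$ otherwise. For $h\in[H]$, $$\bar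 V^*_h(s,b)=\max\Big\{r_h(s,a)+\sum_{s':P_h(s'|s,a)>0}P_h(s'\mid s,a)\bar V^*_{h+1}(s',b_{s'})\Big\},$$ the max being over $a\in\mathcal A_h(s)$ and $\mathbf b\in\mathcal B^S$ with $c_h(s,a)+f_{s'}g(P_h(s'\mid s,a))b_{s'}\le b$, and $\max\emptyset=-\infty$. Auxiliary dynamic program. For $F\in\mathbb R^m$, $\bar V^{s,a}_{h,b}(S+1,F)=0$ if $c_h(s,a)+F\le b$ and $-\infty$ otherwise. For $t\in[S]$, $$\bar V^{s,a}_{h,b}(t,F)=\max_{b_t\in\mathcal B}\Big[P_h(t\mid s,a)\bar V^*_{h+1}(t,b_t)+\bar V^{s,a}_{h,b}\big(t+1,f(F,g(P_h(t\mid s,a))b_t)\big)\Big],$$ with the convention $0\cdot(-\infty)=0$. *)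

theory Defs
  imports "HOL-Analysis.Analysis"
begin

text \<open>
  Costs live in \<open>real ^ 'm\<close>, whose order is componentwise and whose supremum norm is
  \<^const>\<open>infnorm\<close>. Time steps and states are natural numbers counted from 1. The sets of relevant
  time steps, states and actions are carved out by \<open>is_cmdp\<close> below; record fields are irrelevant
  outside of them.
\<close>

record ('a, 'm) cmdp =
  horizon :: nat
  nstates :: nat
  acts :: "nat \<Rightarrow> nat \<Rightarrow> 'a set"
  tprob :: "nat \<Rightarrow> nat \<Rightarrow> 'a \<Rightarrow> nat \<Rightarrow> real"
  reward :: "nat \<Rightarrow> nat \<Rightarrow> 'a \<Rightarrow> real"
  cost :: "nat \<Rightarrow> nat \<Rightarrow> 'a \<Rightarrow> real ^ 'm"
  init :: nat

abbreviation states :: "('a, 'm::finite) cmdp \<Rightarrow> nat set" where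
  "states M \<equiv> {1..nstates M}"

definition prob_vector :: "nat \<Rightarrow> (nat \<Rightarrow> real) \<Rightarrow> bool" where
  "prob_vector n p \<longleftrightarrow> (\<forall>i\<in>{1..n}. 0 \<le> p i) \<and> (\<Sum>i=1..n. p i) = 1"

definition is_cmdp :: "('a, 'm::finite) cmdp \<Rightarrow> bool" where
  "is_cmdp M \<longleftrightarrow>
     init M \<in> states M \<and>
     (\<forall>h\<in>{1..horizon M}. \<forall>s\<in>states M. finite (acts M h s) \<and>
        (\<forall>a\<in>acts M h s. prob_vector (nstates M) (tprob M h s a)))"

text \<open>\<open>f y\<^sub>1 (f y\<^sub>2 (\<dots> y\<^sub>n))\<close>, for \<open>n \<ge> 1\<close>.\<close>

definition nested :: "('b \<Rightarrow> 'b \<Rightarrow> 'b) \<Rightarrow> nat \<Rightarrow> (nat \<Rightarrow> 'b) \<Rightarrow> 'b" where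
  "nested f n y = foldr f (map y [1..<n]) (y n)"

text \<open>In the last clause the argument ranges over \<open>n\<close>-tuples of cost vectors, so its supremum
  norm is the maximum of the supremum norms of the \<open>n\<close> vectors.\<close>

definition sr_functions ::
    "nat \<Rightarrow> (real ^ 'm::finite \<Rightarrow> real ^ 'm \<Rightarrow> real ^ 'm) \<Rightarrow> (real \<Rightarrow> real) \<Rightarrow> bool" where
  "sr_functions n f g \<longleftrightarrow>
     (\<forall>x y z. f (f x y) z = f x (f y z)) \<and>
     (\<forall>x x' y. x \<le> x' \<longrightarrow> f x y \<le> f x' y) \<and>
     (\<forall>x y y'. y \<le> y' \<longrightarrow> f x y \<le> f x y') \<and>
     (\<forall>x x' y. infnorm (f x y - f x' y) \<le> infnorm (x - x')) \<and>
     (\<forall>x y y'. infnorm (f x y - f x y') \<le> infnorm (y - y')) \<and>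
     (\<forall>x. f 0 x = x \<and> f x 0 = x) \<and>
     g \<in> {0..1} \<rightarrow> {0..1} \<and> g 0 = 0 \<and>
     (\<forall>p. prob_vector n p \<longrightarrow>
        (\<forall>x x'. infnorm (nested f n (\<lambda>i. g (p i) *\<^sub>R x i) - nested f n (\<lambda>i. g (p i) *\<^sub>R x' i))
           \<le> Max ((\<lambda>i. infnorm (x i - x' i)) ` {1..n})))"

text \<open>A history \<open>(s\<^sub>1, a\<^sub>1, \<dots>, s\<^sub>h\<^sub>-\<^sub>1, a\<^sub>h\<^sub>-\<^sub>1, s\<^sub>h)\<close> is represented by the list of its past
  state-action pairs together with the current state.\<close>

type_synonym 'a hist = "(nat \<times> 'a) list \<times> nat"

definition hist_extend :: "'a hist \<Rightarrow> 'a \<Rightarrow> nat \<Rightarrow> 'a hist" where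
  "hist_extend \<tau> a s' = (fst \<tau> @ [(snd \<tau>, a)], s')"

inductive history :: "('a, 'm::finite) cmdp \<Rightarrow> nat \<Rightarrow> 'a hist \<Rightarrow> bool" for M where
  start: "history M 1 ([], init M)"
| extend: "history M h \<tau> \<Longrightarrow> h \<le> horizon M \<Longrightarrow> a \<in> acts M h (snd \<tau>) \<Longrightarrow> s' \<in> states M \<Longrightarrow>
    history M (Suc h) (hist_extend \<tau> a s')"

definition policy :: "('a, 'm::finite) cmdp \<Rightarrow> ('a hist \<Rightarrow> 'a) \<Rightarrow> bool" where
  "policy M \<pi> \<longleftrightarrow>
     (\<forall>h\<in>{1..horizon M}. \<forall>\<tau>. history M h \<tau> \<longrightarrow> \<pi> \<tau> \<in> acts M h (snd \<tau>))"

function sr_cost :: "('a, 'm::finite) cmdp \<Rightarrow> (real ^ 'm \<Rightarrow> real ^ 'm \<Rightarrow> real ^ 'm) \<Rightarrow>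
    (real \<Rightarrow> real) \<Rightarrow> ('a hist \<Rightarrow> 'a) \<Rightarrow> nat \<Rightarrow> 'a hist \<Rightarrow> real ^ 'm" where
  "sr_cost M f g \<pi> h \<tau> =
     (if horizon M < h then 0
      else let s = snd \<tau>; a = \<pi> \<tau> in
        cost M h s a +
        nested f (nstates M)
          (\<lambda>s'. g (tprob M h s a s') *\<^sub>R sr_cost M f g \<pi> (Suc h) (hist_extend \<tau> a s')))"
  by pat_completeness auto
termination
  by (relation "Wellfounded.measure (\<lambda>(M, f, g, \<pi>, h, \<tau>). Suc (horizon M) - h)") auto

declare sr_cost.simps [simp del]

definition budgets :: "('a, 'm::finite) cmdp \<Rightarrow> (real ^ 'm \<Rightarrow> real ^ 'm \<Rightarrow> real ^ 'm) \<Rightarrow>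
    (real \<Rightarrow> real) \<Rightarrow> (real ^ 'm) set" where
  "budgets M f g =
     {sr_cost M f g \<pi> h \<tau> | \<pi> h \<tau>. policy M \<pi> \<and> h \<in> {1..Suc (horizon M)} \<and> history M h \<tau>}"

text \<open>Values are extended reals, where \<open>0 * -\<infinity> = 0\<close> holds by definition.\<close>

definition emax :: "ereal set \<Rightarrow> ereal" where
  "emax X = (if X = {} then -\<infinity> else Max X)"

function opt_value :: "('a, 'm::finite) cmdp \<Rightarrow> (real ^ 'm \<Rightarrow> real ^ 'm \<Rightarrow> real ^ 'm) \<Rightarrow>
    (real \<Rightarrow> real) \<Rightarrow> nat \<Rightarrow> nat \<Rightarrow> real ^ 'm \<Rightarrow> ereal" where
  "opt_value M f g h s b =
     (if horizon M < h then (if 0 \<le> b then 0 else -\<infinity>)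
      else emax
        {ereal (reward M h s a) +
           (\<Sum>s' | s' \<in> states M \<and> tprob M h s a s' > 0.
              ereal (tprob M h s a s') * opt_value M f g (Suc h) s' (\<beta> s'))
         | a \<beta>. a \<in> acts M h s \<and> \<beta> \<in> states M \<rightarrow>\<^sub>E budgets M f g \<and>
             cost M h s a + nested f (nstates M) (\<lambda>s'. g (tprob M h s a s') *\<^sub>R \<beta> s') \<le> b})"
  by pat_completeness auto
termination
  by (relation "Wellfounded.measure (\<lambda>(M, f, g, h, s, b). Suc (horizon M) - h)") auto

declare opt_value.simps [simp del]

function aux_value :: "('a, 'm::finite) cmdp \<Rightarrow> (real ^ 'm \<Rightarrow> real ^ 'm \<Rightarrow> real ^ 'm) \<Rightarrow>
    (real \<Rightarrow> real) \<Rightarrow> nat \<Rightarrow> nat \<Rightarrow> 'a \<Rightarrow> real ^ 'm \<Rightarrow> nat \<Rightarrow> real ^ 'm \<Rightarrow> ereal" where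
  "aux_value M f g h s a b t F =
     (if nstates M < t then (if cost M h s a + F \<le> b then 0 else -\<infinity>)
      else emax
        ((\<lambda>\<beta>. ereal (tprob M h s a t) * opt_value M f g (Suc h) t \<beta> +
              aux_value M f g h s a b (Suc t) (f F (g (tprob M h s a t) *\<^sub>R \<beta>)))
         ` budgets M f g))"
  by pat_completeness auto
termination
  by (relation "Wellfounded.measure (\<lambda>(M, f, g, h, s, a, b, t, F). Suc (nstates M) - t)") auto

declare aux_value.simps [simp del]

lemma history_state: "history M h \<tau> \<Longrightarrow> init M \<in> states M \<Longrightarrow> snd \<tau> \<in> states M"
  by (induction rule: history.induct) (auto simp: hist_extend_def)

lemma nested_cong: "n \<ge> 1 \<Longrightarrow> (\<And>i. i \<in> {1..n} \<Longrightarrow> y i = z i) \<Longrightarrow> nested f n y = nested f n z"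
  unfolding nested_def by (intro foldr_cong map_cong) (auto cong: map_cong)

text \<open>The maxima above are taken over finite sets, hence attained.\<close>

lemma finite_budgets:
  fixes M :: "('a, 'm::finite) cmdp"
  assumes M: "is_cmdp M"
  shows "finite (budgets M f g)"
proof -
  have st: "init M \<in> states M" using M by (simp add: is_cmdp_def)
  define V where "V h = {sr_cost M f g \<pi> h \<tau> | \<pi> \<tau>. policy M \<pi> \<and> history M h \<tau>}" for h
  have base: "V (Suc (horizon M)) \<subseteq> {0}"
    by (auto simp: V_def sr_cost.simps)
  have step: "finite (V h)" if h: "h \<in> {1..horizon M}" and IH: "finite (V (Suc h))" for h
  proof -
    let ?G = "\<lambda>(s, a, y). cost M h s a + nested f (nstates M) (\<lambda>s'. g (tprob M h s a s') *\<^sub>R y s')"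
    let ?D = "Sigma (states M) (\<lambda>s. acts M h s \<times> (states M \<rightarrow>\<^sub>E V (Suc h)))"
    have "finite ?D"
      using M h IH by (intro finite_SigmaI finite_cartesian_product finite_PiE) (auto simp: is_cmdp_def)
    moreover have "V h \<subseteq> ?G ` ?D"
    proof
      fix v assume "v \<in> V h"
      then obtain \<pi> \<tau> where v: "v = sr_cost M f g \<pi> h \<tau>" and p: "policy M \<pi>" and t: "history M h \<tau>"
        by (auto simp: V_def)
      define s where "s = snd \<tau>"
      define a where "a = \<pi> \<tau>"
      define y where "y = restrict (\<lambda>s'. sr_cost M f g \<pi> (Suc h) (hist_extend \<tau> a s')) (states M)"
      have s: "s \<in> states M" using history_state[OF t st] by (simp add: s_def)
      have a: "a \<in> acts M h s" using p t h unfolding policy_def a_def s_def by blast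
      have "sr_cost M f g \<pi> (Suc h) (hist_extend \<tau> a s') \<in> V (Suc h)" if "s' \<in> states M" for s'
      proof -
        have "history M (Suc h) (hist_extend \<tau> a s')"
          using t h a that by (intro history.extend) (auto simp: s_def)
        then show ?thesis using p unfolding V_def by blast
      qed
      then have y: "y \<in> states M \<rightarrow>\<^sub>E V (Suc h)"
        unfolding y_def by (simp add: restrict_PiE_iff)
      have "v = cost M h s a + nested f (nstates M)
          (\<lambda>s'. g (tprob M h s a s') *\<^sub>R sr_cost M f g \<pi> (Suc h) (hist_extend \<tau> a s'))"
        using h by (subst v, subst sr_cost.simps) (simp add: s_def a_def Let_def)
      also have "\<dots> = ?G (s, a, y)"
        using st by (auto intro!: nested_cong simp: y_def)
      finally show "v \<in> ?G ` ?D" using s a y by blast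
    qed
    ultimately show ?thesis by (meson finite_surj)
  qed
  have "finite (V h)" if "h \<le> Suc (horizon M)" "1 \<le> h" for h
    using that
  proof (induction rule: inc_induct)
    case base
    then show ?case using \<open>V (Suc (horizon M)) \<subseteq> {0}\<close> finite_subset by blast
  next
    case (step n)
    then show ?case using \<open>\<And>h. h \<in> {1..horizon M} \<Longrightarrow> finite (V (Suc h)) \<Longrightarrow> finite (V h)\<close> by auto
  qed
  moreover have "budgets M f g = (\<Union>h\<in>{1..Suc (horizon M)}. V h)"
    unfolding budgets_def V_def by blast
  ultimately show ?thesis by auto
qed

end

theory Submission imports Defs begin

text \<open>
  Unrolling the auxiliary recursion from \<open>t = 1\<close>, \<open>F = 0\<close> turns it into a single maximum over all
  budget assignments \<open>\<beta>\<close> of the expected value plus a penalty that is \<open>0\<close> if \<open>\<beta>\<close> is feasible and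
  \<open>-\<infinity>\<close> otherwise: associativity of \<open>f\<close> and \<open>f x 0 = x\<close> identify the accumulated left-nested cost
  with the right-nested one. Reduced values never equal \<open>\<infinity>\<close>, so the penalty eliminates exactly the
  infeasible assignments, and states of probability \<open>0\<close> contribute \<open>0 * -\<infinity> = 0\<close>.
\<close>

text \<open>In \<open>ereal\<close> the supremum of the empty set is \<open>-\<infinity>\<close>,
  which agrees with the convention in \<open>emax\<close>. Finite maxima, empty ones included, can
  thus be handled by the \<open>SUP\<close> rules.\<close>

lemma emax_eq_Sup: "finite X \<Longrightarrow> emax X = Sup X"
  by (simp add: emax_def Max_Sup bot_ereal_def)

lemma emax_not_PInf: "finite X \<Longrightarrow> \<infinity> \<notin> X \<Longrightarrow> emax X \<noteq> \<infinity>"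
  using Max_in[of X] by (cases "X = {}") (simp_all add: emax_def del: Max_in, metis)

text \<open>The list ends in \<open>n\<close>, and the right unit absorbs the seed:
  \<open>f (y n) e = y n\<close>. Unlike \<open>nested\<close>, the seeded fold also makes sense on
  an empty list.\<close>

lemma nested_eq_foldr:
  assumes "n \<ge> 1" "\<And>x. f x e = x"
  shows "nested f n y = foldr f (map y [1..<Suc n]) e"
  using assms by (simp add: nested_def)

section \<open>Unrolled form of the auxiliary program\<close>

definition transition_value where
  "transition_value M f g h s a \<beta> t =
     (\<Sum>i=t..nstates M. ereal (tprob M h s a i) * opt_value M f g (Suc h) i (\<beta> i))"

text \<open>The seed \<open>0\<close> is the unit of \<open>f\<close>, so the empty suffix
  \<open>t = Suc (nstates M)\<close> has cost \<open>0\<close> and can serve as base case of an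
  induction downward in \<open>t\<close>.\<close>

definition accumulated_cost where
  "accumulated_cost M f g h s a \<beta> t =
     foldr f (map (\<lambda>i. g (tprob M h s a i) *\<^sub>R \<beta> i) [t..<Suc (nstates M)]) 0"

definition budget_penalty ::
    "('a, 'm::finite) cmdp \<Rightarrow> nat \<Rightarrow> nat \<Rightarrow> 'a \<Rightarrow> real ^ 'm \<Rightarrow> real ^ 'm \<Rightarrow> ereal" where
  "budget_penalty M h s a b x = (if cost M h s a + x \<le> b then 0 else -\<infinity>)"

lemma transition_value_step:
  "t \<le> nstates M \<Longrightarrow> transition_value M f g h s a \<beta> t =
     ereal (tprob M h s a t) * opt_value M f g (Suc h) t (\<beta> t) +
     transition_value M f g h s a \<beta> (Suc t)"
  by (simp add: transition_value_def sum.atLeast_Suc_atMost)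

lemma accumulated_cost_step:
  "t \<le> nstates M \<Longrightarrow> accumulated_cost M f g h s a \<beta> t =
     f (g (tprob M h s a t) *\<^sub>R \<beta> t) (accumulated_cost M f g h s a \<beta> (Suc t))"
  unfolding accumulated_cost_def by (subst upt_conv_Cons) auto

lemma transition_value_cong:
  "(\<And>i. t \<le> i \<Longrightarrow> i \<le> nstates M \<Longrightarrow> \<beta> i = \<gamma> i) \<Longrightarrow>
    transition_value M f g h s a \<beta> t = transition_value M f g h s a \<gamma> t"
  unfolding transition_value_def by (intro sum.cong) auto

lemma accumulated_cost_cong:
  assumes "\<And>i. t \<le> i \<Longrightarrow> i \<le> nstates M \<Longrightarrow> \<beta> i = \<gamma> i"
  shows "accumulated_cost M f g h s a \<beta> t = accumulated_cost M f g h s a \<gamma> t"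
proof -
  have "map (\<lambda>i. g (tprob M h s a i) *\<^sub>R \<beta> i) [t..<Suc (nstates M)] =
      map (\<lambda>i. g (tprob M h s a i) *\<^sub>R \<gamma> i) [t..<Suc (nstates M)]"
    using assms by (intro map_cong) auto
  then show ?thesis by (simp only: accumulated_cost_def)
qed

text \<open>Here \<open>\<beta>\<close> is arbitrary: past the last state the sum and the fold are
  empty, and the unit law leaves just \<open>F\<close>.\<close>

lemma aux_value_leaf:
  assumes "\<And>x. f x 0 = x"
  shows "aux_value M f g h s a b (Suc (nstates M)) F =
    transition_value M f g h s a \<beta> (Suc (nstates M)) +
    budget_penalty M h s a b (f F (accumulated_cost M f g h s a \<beta> (Suc (nstates M))))"
  using assms
  by (simp add: aux_value.simps transition_value_def accumulated_cost_def budget_penalty_def)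

text \<open>Downward induction on \<open>t\<close>: at each stage \<open>\<beta> t\<close> is one of
  the candidates of the maximum. \<open>F\<close> is generalized because the recursive call changes
  the accumulator.\<close>

lemma aux_value_ge:
  assumes fin: "finite (budgets M f g)"
    and assoc: "\<And>x y z. f (f x y) z = f x (f y z)" and unit: "\<And>x. f x 0 = x"
    and t: "t \<le> Suc (nstates M)" and \<beta>: "\<And>i. i \<in> {t..nstates M} \<Longrightarrow> \<beta> i \<in> budgets M f g"
  shows "transition_value M f g h s a \<beta> t +
      budget_penalty M h s a b (f F (accumulated_cost M f g h s a \<beta> t))
    \<le> aux_value M f g h s a b t F"
  using t \<beta>
proof (induction arbitrary: F rule: inc_induct)
  case base
  show ?case using aux_value_leaf[of f M, OF unit] by (simp add: order_eq_iff)
next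
  case (step t)
  let ?F = "f F (g (tprob M h s a t) *\<^sub>R \<beta> t)"
  let ?v = "\<lambda>x. ereal (tprob M h s a t) * opt_value M f g (Suc h) t x +
      aux_value M f g h s a b (Suc t) (f F (g (tprob M h s a t) *\<^sub>R x))"
  have t: "t \<le> nstates M" using step.hyps by simp
  \<comment> \<open>Associativity moves the cost of state \<open>t\<close> from the front of the
    suffix fold to the end of the accumulator.\<close>
  have "transition_value M f g h s a \<beta> t +
      budget_penalty M h s a b (f F (accumulated_cost M f g h s a \<beta> t)) =
    ereal (tprob M h s a t) * opt_value M f g (Suc h) t (\<beta> t) +
      (transition_value M f g h s a \<beta> (Suc t) +
       budget_penalty M h s a b (f ?F (accumulated_cost M f g h s a \<beta> (Suc t))))"
    using t by (simp add: transition_value_step accumulated_cost_step assoc add.assoc)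
  also have "\<dots> \<le> ?v (\<beta> t)"
    using step.prems by (intro add_left_mono step.IH) auto
  also have "\<dots> \<le> Sup (?v ` budgets M f g)"
    using step.prems t by (intro SUP_upper) auto
  also have "\<dots> = aux_value M f g h s a b t F"
    using t fin by (subst aux_value.simps[of M f g h s a b t F]) (simp add: emax_eq_Sup)
  finally show ?case .
qed

text \<open>Since \<open>budgets M f g\<close> is finite and nonempty, each stage has a genuine
  maximizer; gluing the maximizers of all stages gives \<open>\<beta>\<close>.\<close>

lemma aux_value_attained:
  assumes fin: "finite (budgets M f g)" and ne: "budgets M f g \<noteq> {}"
    and assoc: "\<And>x y z. f (f x y) z = f x (f y z)" and unit: "\<And>x. f x 0 = x"
    and t: "t \<le> Suc (nstates M)"
  obtains \<beta> where "\<And>i. i \<in> {t..nstates M} \<Longrightarrow> \<beta> i \<in> budgets M f g"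
    and "aux_value M f g h s a b t F = transition_value M f g h s a \<beta> t +
      budget_penalty M h s a b (f F (accumulated_cost M f g h s a \<beta> t))"
proof -
  have "\<exists>\<beta>. (\<forall>i\<in>{t..nstates M}. \<beta> i \<in> budgets M f g) \<and>
      aux_value M f g h s a b t F = transition_value M f g h s a \<beta> t +
        budget_penalty M h s a b (f F (accumulated_cost M f g h s a \<beta> t))"
    using t
  proof (induction arbitrary: F rule: inc_induct)
    case base
    show ?case using aux_value_leaf[of f M, OF unit] by auto
  next
    case (step t)
    let ?v = "\<lambda>x. ereal (tprob M h s a t) * opt_value M f g (Suc h) t x +
        aux_value M f g h s a b (Suc t) (f F (g (tprob M h s a t) *\<^sub>R x))"
    have t: "t \<le> nstates M" using step.hyps by simp
    have "Max (?v ` budgets M f g) \<in> ?v ` budgets M f g"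
      using fin ne by (intro Max_in) auto
    moreover have "aux_value M f g h s a b t F = Max (?v ` budgets M f g)"
      using t ne by (subst aux_value.simps) (simp add: emax_def)
    ultimately obtain x where x: "x \<in> budgets M f g" "aux_value M f g h s a b t F = ?v x"
      by auto
    obtain \<gamma> where \<gamma>: "\<forall>i\<in>{Suc t..nstates M}. \<gamma> i \<in> budgets M f g"
      "aux_value M f g h s a b (Suc t) (f F (g (tprob M h s a t) *\<^sub>R x)) =
        transition_value M f g h s a \<gamma> (Suc t) +
        budget_penalty M h s a b (f (f F (g (tprob M h s a t) *\<^sub>R x))
          (accumulated_cost M f g h s a \<gamma> (Suc t)))"
      using step.IH by blast
    \<comment> \<open>The suffix from \<open>Suc t\<close> never reads index \<open>t\<close>, so
      the maximizer \<open>x\<close> can be inserted there without disturbing the later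
      stages.\<close>
    let ?\<beta> = "\<gamma>(t := x)"
    have "transition_value M f g h s a ?\<beta> (Suc t) = transition_value M f g h s a \<gamma> (Suc t)"
      "accumulated_cost M f g h s a ?\<beta> (Suc t) = accumulated_cost M f g h s a \<gamma> (Suc t)"
      by (auto intro!: transition_value_cong accumulated_cost_cong)
    then have "aux_value M f g h s a b t F = transition_value M f g h s a ?\<beta> t +
        budget_penalty M h s a b (f F (accumulated_cost M f g h s a ?\<beta> t))"
      using t x(2) \<gamma>(2)
      by (simp add: transition_value_step accumulated_cost_step assoc add.assoc)
    moreover have "\<forall>i\<in>{t..nstates M}. ?\<beta> i \<in> budgets M f g"
      using \<gamma>(1) x(1) by auto
    ultimately show ?case by blast
  qed
  then show ?thesis using that by blast
qed

section \<open>Reduced optimal values as suprema, and exclusion of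
  \<open>\<infinity>\<close>\<close>

definition feasible where
  "feasible M f g h s b = {(a, \<beta>). a \<in> acts M h s \<and> \<beta> \<in> states M \<rightarrow>\<^sub>E budgets M f g \<and>
     cost M h s a + nested f (nstates M) (\<lambda>s'. g (tprob M h s a s') *\<^sub>R \<beta> s') \<le> b}"

text \<open>Extensionality in \<open>PiE\<close> leaves only finitely many budget vectors.\<close>

lemma finite_feasible:
  assumes "is_cmdp M" "h \<in> {1..horizon M}" "s \<in> states M"
  shows "finite (feasible M f g h s b)"
proof (rule finite_subset)
  show "feasible M f g h s b \<subseteq> acts M h s \<times> (states M \<rightarrow>\<^sub>E budgets M f g)"
    by (auto simp: feasible_def)
  show "finite (acts M h s \<times> (states M \<rightarrow>\<^sub>E budgets M f g))"
    using assms by (intro finite_cartesian_product finite_PiE finite_budgets) (auto simp: is_cmdp_def)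
qed

lemma opt_value_eq_SUP:
  assumes M: "is_cmdp M" and h: "h \<in> {1..horizon M}" and s: "s \<in> states M"
  shows "opt_value M f g h s b =
    (SUP (a, \<beta>) \<in> feasible M f g h s b. ereal (reward M h s a) + transition_value M f g h s a \<beta> 1)"
proof -
  have sum_eq: "(\<Sum>s' | s' \<in> states M \<and> tprob M h s a s' > 0.
        ereal (tprob M h s a s') * opt_value M f g (Suc h) s' (\<beta> s'))
      = transition_value M f g h s a \<beta> 1" if "a \<in> acts M h s" for a \<beta>
    unfolding transition_value_def
  proof (rule sum.mono_neutral_left)
    \<comment> \<open>By nonnegativity, the states left out of the sum have probability exactly
      \<open>0\<close>, and their terms vanish even where the value is
      \<open>-\<infinity>\<close>.\<close>
    have "0 \<le> tprob M h s a i" if "i \<in> states M" for i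
      using M h s \<open>a \<in> acts M h s\<close> that by (auto simp: is_cmdp_def prob_vector_def)
    then show "\<forall>i\<in>states M - {s'. s' \<in> states M \<and> tprob M h s a s' > 0}.
        ereal (tprob M h s a i) * opt_value M f g (Suc h) i (\<beta> i) = 0"
      by (force simp: not_less intro: antisym)
  qed auto
  let ?R = "\<lambda>a \<beta>. ereal (reward M h s a) +
      (\<Sum>s' | s' \<in> states M \<and> tprob M h s a s' > 0.
        ereal (tprob M h s a s') * opt_value M f g (Suc h) s' (\<beta> s'))"
  have "opt_value M f g h s b = emax ((\<lambda>(a, \<beta>). ?R a \<beta>) ` feasible M f g h s b)"
    using h by (subst opt_value.simps) (auto simp: feasible_def image_def intro!: arg_cong[of _ _ emax])
  also have "(\<lambda>(a, \<beta>). ?R a \<beta>) ` feasible M f g h s b =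
      (\<lambda>(a, \<beta>). ereal (reward M h s a) + transition_value M f g h s a \<beta> 1) ` feasible M f g h s b"
    by (intro image_cong refl, clarify, subst sum_eq) (simp_all add: feasible_def)
  finally show ?thesis
    using finite_feasible[OF M h s] by (simp add: emax_eq_Sup)
qed

text \<open>A nonnegative weight cannot turn \<open>-\<infinity>\<close> into
  \<open>\<infinity>\<close>, and a finite sum is \<open>\<infinity>\<close> only if some summand
  is.\<close>

lemma transition_value_not_PInf:
  assumes M: "is_cmdp M" and h: "h \<in> {1..horizon M}" and s: "s \<in> states M" and a: "a \<in> acts M h s"
    and V: "\<And>i x. i \<in> states M \<Longrightarrow> opt_value M f g (Suc h) i x \<noteq> \<infinity>"
  shows "transition_value M f g h s a \<beta> 1 \<noteq> \<infinity>"
proof -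
  have "ereal (tprob M h s a i) * opt_value M f g (Suc h) i (\<beta> i) \<noteq> \<infinity>" if i: "i \<in> states M" for i
  proof -
    have "0 \<le> tprob M h s a i"
      using M h s a i by (auto simp: is_cmdp_def prob_vector_def)
    then show ?thesis
      using V[OF i, of "\<beta> i"] by (cases "opt_value M f g (Suc h) i (\<beta> i)") auto
  qed
  then show ?thesis by (simp add: transition_value_def sum_Pinfty)
qed

text \<open>Needed because \<open>\<infinity> + -\<infinity> = \<infinity>\<close> in
  \<open>ereal\<close>: an infinite value would override the penalty. Backward induction from the
  final stage works because the maximum is over a finite set; an infinite set of finite values could
  have supremum \<open>\<infinity>\<close>.\<close>

lemma opt_value_not_PInf:
  assumes M: "is_cmdp M" and h: "1 \<le> h" "h \<le> Suc (horizon M)" and s: "s \<in> states M"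
  shows "opt_value M f g h s b \<noteq> \<infinity>"
  using h(2,1) s
proof (induction arbitrary: s b rule: inc_induct)
  case base
  show ?case by (simp add: opt_value.simps)
next
  case (step h)
  then have h: "h \<in> {1..horizon M}" by simp
  let ?X = "(\<lambda>(a, \<beta>). ereal (reward M h s a) + transition_value M f g h s a \<beta> 1) ` feasible M f g h s b"
  have "\<infinity> \<notin> ?X"
    using transition_value_not_PInf[OF M h step.prems(2)] step.IH
    by (auto simp: feasible_def)
  moreover have "finite ?X" using finite_feasible[OF M h step.prems(2)] by simp
  ultimately have "emax ?X \<noteq> \<infinity>"
    using emax_not_PInf by blast
  then show ?case
    unfolding opt_value_eq_SUP[OF M h step.prems(2)] emax_eq_Sup[OF \<open>finite ?X\<close>] .
qed

section \<open>Equality of the two dynamic programs\<close>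

theorem mainTheorem7:
  fixes M :: "('a, 'm::finite) cmdp"
    and f :: "real ^ 'm \<Rightarrow> real ^ 'm \<Rightarrow> real ^ 'm"
    and g :: "real \<Rightarrow> real"
    and h s :: nat
    and b :: "real ^ 'm"
  assumes "is_cmdp M"
    and "sr_functions (nstates M) f g"
    and "h \<in> {1..horizon M}"
    and "s \<in> states M"
    and "b \<in> budgets M f g"
  shows "opt_value M f g h s b =
    emax ((\<lambda>a. ereal (reward M h s a) + aux_value M f g h s a b 1 0) ` acts M h s)"
proof -
  note M = assms(1) and h = assms(3) and s = assms(4)
  have assoc: "f (f x y) z = f x (f y z)" and unit: "f x 0 = x" "f 0 x = x" for x y z
    using assms(2) by (simp_all add: sr_functions_def)
  have n: "1 \<le> nstates M" using s by simp
  have fin: "finite (budgets M f g)" by (rule finite_budgets[OF M])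
  \<comment> \<open>The given \<open>b\<close> itself witnesses that the auxiliary maxima range over
    a nonempty set.\<close>
  have ne: "budgets M f g \<noteq> {}" using assms(5) by auto
  \<comment> \<open>The outer \<open>f 0\<close> is kept so that the feasibility constraint
    literally matches the penalty at the initial accumulator \<open>F = 0\<close>.\<close>
  have nested: "nested f (nstates M) (\<lambda>i. g (tprob M h s a i) *\<^sub>R \<beta> i) =
      f 0 (accumulated_cost M f g h s a \<beta> 1)" for a \<beta>
    using nested_eq_foldr[of "nstates M" f 0, OF n unit(1)]
    by (simp only: accumulated_cost_def unit(2))
  let ?R = "\<lambda>a. ereal (reward M h s a) + aux_value M f g h s a b 1 0"
  have "opt_value M f g h s b = Sup (?R ` acts M h s)"
    unfolding opt_value_eq_SUP[OF M h s]
  proof (rule antisym)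
    show "(SUP (a, \<beta>) \<in> feasible M f g h s b.
        ereal (reward M h s a) + transition_value M f g h s a \<beta> 1) \<le> Sup (?R ` acts M h s)"
    proof (rule SUP_least, clarify)
      fix a \<beta> assume "(a, \<beta>) \<in> feasible M f g h s b"
      then have a: "a \<in> acts M h s" and \<beta>: "\<And>i. i \<in> states M \<Longrightarrow> \<beta> i \<in> budgets M f g"
        and le: "cost M h s a + f 0 (accumulated_cost M f g h s a \<beta> 1) \<le> b"
        by (auto simp: feasible_def nested)
      have "transition_value M f g h s a \<beta> 1 \<le> aux_value M f g h s a b 1 0"
        using aux_value_ge[where t = 1 and F = 0 and h = h and s = s and a = a and b = b and \<beta> = \<beta>,
            OF fin assoc unit(1) _ \<beta>] le
        by (simp add: budget_penalty_def)
      then have "ereal (reward M h s a) + transition_value M f g h s a \<beta> 1 \<le> ?R a"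
        by (rule add_left_mono)
      also have "\<dots> \<le> Sup (?R ` acts M h s)" using a by (rule SUP_upper)
      finally show "ereal (reward M h s a) + transition_value M f g h s a \<beta> 1
        \<le> Sup (?R ` acts M h s)" .
    qed
  next
    show "Sup (?R ` acts M h s) \<le> (SUP (a, \<beta>) \<in> feasible M f g h s b.
        ereal (reward M h s a) + transition_value M f g h s a \<beta> 1)"
    proof (rule SUP_least)
      fix a assume a: "a \<in> acts M h s"
      obtain \<gamma> where \<gamma>: "\<And>i. i \<in> states M \<Longrightarrow> \<gamma> i \<in> budgets M f g"
        and val: "aux_value M f g h s a b 1 0 = transition_value M f g h s a \<gamma> 1 +
          budget_penalty M h s a b (f 0 (accumulated_cost M f g h s a \<gamma> 1))"
        using aux_value_attained[where t = 1, OF fin ne assoc unit(1)] by (metis le_add1 plus_1_eq_Suc)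
      \<comment> \<open>Outside the states \<open>\<gamma>\<close> is uncontrolled; restricting it
        yields a member of the extensional function space and leaves the sum and the cost
        unchanged.\<close>
      define \<beta> where "\<beta> = restrict \<gamma> (states M)"
      have \<beta>: "\<beta> \<in> states M \<rightarrow>\<^sub>E budgets M f g" using \<gamma> by (auto simp: \<beta>_def)
      have "transition_value M f g h s a \<beta> 1 = transition_value M f g h s a \<gamma> 1"
        "accumulated_cost M f g h s a \<beta> 1 = accumulated_cost M f g h s a \<gamma> 1"
        by (auto intro!: transition_value_cong accumulated_cost_cong simp: \<beta>_def)
      then have val: "aux_value M f g h s a b 1 0 = transition_value M f g h s a \<beta> 1 +
          budget_penalty M h s a b (f 0 (accumulated_cost M f g h s a \<beta> 1))"
        using val by simp
      show "?R a \<le> (SUP (a, \<beta>) \<in> feasible M f g h s b.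
          ereal (reward M h s a) + transition_value M f g h s a \<beta> 1)"
      proof (cases "cost M h s a + f 0 (accumulated_cost M f g h s a \<beta> 1) \<le> b")
        case True
        then have "(a, \<beta>) \<in> feasible M f g h s b"
          using a \<beta> by (auto simp: feasible_def nested)
        moreover have "?R a = ereal (reward M h s a) + transition_value M f g h s a \<beta> 1"
          using True val by (simp add: budget_penalty_def)
        ultimately show ?thesis by (auto intro: SUP_upper2)
      next
        case False
        \<comment> \<open>If even the maximizing assignment is infeasible, the penalty
          \<open>-\<infinity>\<close> must win the sum, and the bound for this action becomes
          trivial.\<close>
        have "transition_value M f g h s a \<beta> 1 \<noteq> \<infinity>"
          using h by (intro transition_value_not_PInf[OF M h s a] opt_value_not_PInf[OF M]) auto
        then have "?R a = -\<infinity>"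
          using False val by (simp add: budget_penalty_def ereal_plus_eq_MInfty)
        then show ?thesis by simp
      qed
    qed
  qed
  moreover have "finite (acts M h s)" using M h s by (auto simp: is_cmdp_def)
  ultimately show ?thesis by (simp add: emax_eq_Sup)
qed

end
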